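(* Let $G$ be a non-trivial Hausdorff topological group and let $\mathcal{M}$ be the collection of components of $G$. (1) If $G$ is of semisimple type, then $\mathcal{M}$ is a generalized central factorization of $G$ and each $M\in \mathcal{M}$ is non-abelian and central-by-topologically simple. (2) If $G$ is of strict semisimple type, then $\mathcal{M}$ is a quasi-direct factorization of $G$ and each $M\in \mathcal{M}$ is non-abelian and topologically simple.
   Context: For a topological group $G$ and a subset $M\subseteq G$, write $\overline{\langle\langle M\rangle\rangle_G}$ for the smallest closed normal subgroup of $G$ containing $M$. A component of $G$ is a closed subgroup $M$ of $G$ such that: (a) $M$ is normal in $\overline{\langle\langle M\rangle\rangle_G}$; (b) $M/\mathrm{Z}(M)$ is non-abelian; (c) whenever $K$ is a proper closed normal subgroup of $M$, then $K$ is central in $\overline{\langle\langle M\rangle\rangle_G}$. The layer $E(G)$ is the closed subgroup of $G$ generated by all components. $G$ is of semisimple type if $G=E(G)$, and of strict semisimple type if in addition $\mathrm{Z}(G)=\{1\}$. For a set $J$ of closed normal subgroups of $G$, let $G_J:=\overline{\langle N\mid N\in J\rangle}$ (so $G_\emptyset = \{1\}$). A set $\mathcal{S}$ of closed normal subgroups of $G$ is a generalized central factorization of $G$ if $\{1\}\notin\mathcal{S}$, $G_{\mathcal{S}}=G$, and $[N,M]=\{1\}$ for any $N\neq M$ in $\mathcal{S}$. It is a quasi-direct factorization of $G$ if $\{1\}\notin\mathcal{S}$, $G_{\mathcal{S}}=G$, and for every set $X$ of subsets of $\mathcal{S}$ with $\bigcap X=\emptyset$ one has $\bigcap_{A\in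 X}G_A=\{1\}$ (the empty intersection of subsets of $\mathcal S$ being $\mathcal{S}$). A topological group is topologically simple if it is non-trivial and has no proper non-trivial closed normal subgroup. A topological group $M$ is central-by-topologically simple if $M/\mathrm{Z}(M)$ is topologically simple. *)

theory Defs
  imports "HOL-Algebra.Generated_Groups" "HOL-Analysis.T1_Spaces"
begin

section \<open>Topological groups\<close>

locale topological_group = group G for G (structure) +
  fixes T :: "'a topology"
  assumes topspace_eq_carrier: "topspace T = carrier G"
    and continuous_mult: "continuous_map (prod_topology T T) T (\<lambda>(x, y). x \<otimes> y)"
    and continuous_inv: "continuous_map T T (\<lambda>x. inv x)"

locale topologically_simple = topological_group +
  assumes nontrivial: "carrier G \<noteq> {\<one>}"
    and no_proper_closed_normal: "\<And>N. \<lbrakk>N \<lhd> G; closedin T N\<rbrakk> \<Longrightarrow> N = {\<one>} \<or> N = carrier G"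

definition quotient_topology :: "'a topology \<Rightarrow> ('a \<Rightarrow> 'b) \<Rightarrow> 'b topology" where
  "quotient_topology X f =
     topology (\<lambda>U. U \<subseteq> f ` topspace X \<and> openin X {x \<in> topspace X. f x \<in> U})"

lemma openin_quotient_topology:
  "openin (quotient_topology X f) U \<longleftrightarrow>
     U \<subseteq> f ` topspace X \<and> openin X {x \<in> topspace X. f x \<in> U}"
proof -
  have "istopology (\<lambda>U. U \<subseteq> f ` topspace X \<and> openin X {x \<in> topspace X. f x \<in> U})"
    unfolding istopology_def
  proof (intro conjI allI impI; (elim conjE)?)
    fix S S'
    assume "openin X {x \<in> topspace X. f x \<in> S}" "openin X {x \<in> topspace X. f x \<in> S'}"
    then have "openin X ({x \<in> topspace X. f x \<in> S} \<inter> {x \<in> topspace X. f x \<in> S'})"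
      by (rule openin_Int)
    moreover have "{x \<in> topspace X. f x \<in> S} \<inter> {x \<in> topspace X. f x \<in> S'}
        = {x \<in> topspace X. f x \<in> S \<inter> S'}"
      by auto
    ultimately show "openin X {x \<in> topspace X. f x \<in> S \<inter> S'}"
      by simp
  next
    fix \<K>
    assume \<K>: "\<forall>K\<in>\<K>. K \<subseteq> f ` topspace X \<and> openin X {x \<in> topspace X. f x \<in> K}"
    then have "openin X (\<Union>K\<in>\<K>. {x \<in> topspace X. f x \<in> K})"
      by auto
    moreover have "(\<Union>K\<in>\<K>. {x \<in> topspace X. f x \<in> K}) = {x \<in> topspace X. f x \<in> \<Union>\<K>}"
      by auto
    ultimately show "openin X {x \<in> topspace X. f x \<in> \<Union>\<K>}"
      by simp
  qed auto
  then show ?thesis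
    by (simp add: quotient_topology_def)
qed

lemma topspace_quotient_topology: "topspace (quotient_topology X f) = f ` topspace X"
proof
  show "topspace (quotient_topology X f) \<subseteq> f ` topspace X"
    using openin_topspace[of "quotient_topology X f"] unfolding openin_quotient_topology by blast
  have "{x \<in> topspace X. f x \<in> f ` topspace X} = topspace X"
    by auto
  then have "openin (quotient_topology X f) (f ` topspace X)"
    by (simp add: openin_quotient_topology)
  then show "f ` topspace X \<subseteq> topspace (quotient_topology X f)"
    by (rule openin_subset)
qed

lemma quotient_map_quotient_topology: "quotient_map X (quotient_topology X f) f"
  by (auto simp: quotient_map_def topspace_quotient_topology openin_quotient_topology)

definition group_center :: "('a, 'b) monoid_scheme \<Rightarrow> 'a set" where
  "group_center G = {z \<in> carrier G. \<forall>g\<in>carrier G. z \<otimes>\<^bsub>G\<^esub> g = g \<otimes>\<^bsub>G\<^esub> z}"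

definition central_by_topologically_simple ::
    "('a, 'b) monoid_scheme \<Rightarrow> 'a topology \<Rightarrow> bool" where
  "central_by_topologically_simple G T \<longleftrightarrow>
     topologically_simple (G Mod group_center G)
       (quotient_topology T (\<lambda>x. group_center G #>\<^bsub>G\<^esub> x))"

definition closed_subgroup_generated ::
    "('a, 'b) monoid_scheme \<Rightarrow> 'a topology \<Rightarrow> 'a set \<Rightarrow> 'a set" where
  "closed_subgroup_generated G T X = \<Inter>{H. subgroup H G \<and> closedin T H \<and> X \<subseteq> H}"

definition closed_normal_closure ::
    "('a, 'b) monoid_scheme \<Rightarrow> 'a topology \<Rightarrow> 'a set \<Rightarrow> 'a set" where
  "closed_normal_closure G T X = \<Inter>{N. N \<lhd> G \<and> closedin T N \<and> X \<subseteq> N}"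

definition commutator_subgroup ::
    "('a, 'b) monoid_scheme \<Rightarrow> 'a set \<Rightarrow> 'a set \<Rightarrow> 'a set" where
  "commutator_subgroup G A B =
     generate G (\<Union>a\<in>A. \<Union>b\<in>B. {a \<otimes>\<^bsub>G\<^esub> b \<otimes>\<^bsub>G\<^esub> inv\<^bsub>G\<^esub> a \<otimes>\<^bsub>G\<^esub> inv\<^bsub>G\<^esub> b})"

section \<open>Components and groups of semisimple type\<close>

definition group_component ::
    "('a, 'b) monoid_scheme \<Rightarrow> 'a topology \<Rightarrow> 'a set \<Rightarrow> bool" where
  "group_component G T M \<longleftrightarrow>
     subgroup M G \<and> closedin T M \<and>
     M \<lhd> G\<lparr>carrier := closed_normal_closure G T M\<rparr> \<and>
     \<not> comm_group (G\<lparr>carrier := M\<rparr> Mod group_center (G\<lparr>carrier := M\<rparr>)) \<and>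
     (\<forall>K. K \<lhd> G\<lparr>carrier := M\<rparr> \<and> closedin (subtopology T M) K \<and> K \<noteq> M \<longrightarrow>
        K \<subseteq> group_center (G\<lparr>carrier := closed_normal_closure G T M\<rparr>))"

definition group_components ::
    "('a, 'b) monoid_scheme \<Rightarrow> 'a topology \<Rightarrow> 'a set set" where
  "group_components G T = {M. group_component G T M}"

definition layer :: "('a, 'b) monoid_scheme \<Rightarrow> 'a topology \<Rightarrow> 'a set" where
  "layer G T = closed_subgroup_generated G T (\<Union>(group_components G T))"

definition semisimple_type :: "('a, 'b) monoid_scheme \<Rightarrow> 'a topology \<Rightarrow> bool" where
  "semisimple_type G T \<longleftrightarrow> carrier G = layer G T"

definition strict_semisimple_type :: "('a, 'b) monoid_scheme \<Rightarrow> 'a topology \<Rightarrow> bool" where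
  "strict_semisimple_type G T \<longleftrightarrow> semisimple_type G T \<and> group_center G = {\<one>\<^bsub>G\<^esub>}"

section \<open>Factorizations\<close>

definition generalized_central_factorization ::
    "('a, 'b) monoid_scheme \<Rightarrow> 'a topology \<Rightarrow> 'a set set \<Rightarrow> bool" where
  "generalized_central_factorization G T S \<longleftrightarrow>
     (\<forall>N\<in>S. N \<lhd> G \<and> closedin T N) \<and>
     {\<one>\<^bsub>G\<^esub>} \<notin> S \<and>
     closed_subgroup_generated G T (\<Union>S) = carrier G \<and>
     (\<forall>N\<in>S. \<forall>M\<in>S. N \<noteq> M \<longrightarrow> commutator_subgroup G N M = {\<one>\<^bsub>G\<^esub>})"

text \<open>
  In the next definition the intersections are relative to \<open>S\<close> and to \<open>carrier G\<close>, so that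
  for \<open>X = {}\<close> they are \<open>S\<close> and \<open>carrier G\<close> respectively, rather than \<open>UNIV\<close>.
\<close>

definition quasi_direct_factorization ::
    "('a, 'b) monoid_scheme \<Rightarrow> 'a topology \<Rightarrow> 'a set set \<Rightarrow> bool" where
  "quasi_direct_factorization G T S \<longleftrightarrow>
     (\<forall>N\<in>S. N \<lhd> G \<and> closedin T N) \<and>
     {\<one>\<^bsub>G\<^esub>} \<notin> S \<and>
     closed_subgroup_generated G T (\<Union>S) = carrier G \<and>
     (\<forall>X. X \<subseteq> Pow S \<and> S \<inter> \<Inter>X = {} \<longrightarrow>
        carrier G \<inter> (\<Inter>A\<in>X. closed_subgroup_generated G T (\<Union>A)) = {\<one>\<^bsub>G\<^esub>})"

end

theory Submission
  imports Defs "HOL-Analysis.Abstract_Topological_Spaces"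
begin

text \<open>
  The engine is a substitute for perfectness. Let \<open>M\<close> be a component, let \<open>N\<close> be the closed
  normal subgroup that it generates, and let \<open>X\<close> be a set normalized by \<open>M\<close>. If all
  commutators \<open>[m, x]\<close> with \<open>m \<in> M\<close> and \<open>x \<in> X\<close> are central in \<open>N\<close>, then for each
  \<open>x\<close> the map \<open>m \<mapsto> [m, x]\<close> is a homomorphism to an abelian group, hence kills all commutators of
  \<open>M\<close>. The kernels intersect in the centralizer of \<open>X\<close> in \<open>M\<close>, which is normal in \<open>M\<close>, and closed
  because the group is Hausdorff. If it were proper, it would be central in \<open>N\<close>, and
  \<open>M/Z(M)\<close> would be abelian; so \<open>M\<close> centralizes \<open>X\<close>
  (\<open>centralizes_if_commutators_central\<close>).

  Applied three times, this shows that two distinct components \<open>M\<close> and \<open>L\<close> commute. Suppose \<open>M\<close> is not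
  contained in a closed normal subgroup \<open>P\<close> of the whole group. Then \<open>M \<inter> P\<close> is
  central in \<open>N\<close> and contains \<open>[M, N \<inter> P]\<close>. Hence \<open>M\<close>, and with it \<open>N\<close>, centralizes
  \<open>N \<inter> P\<close>. Now \<open>[M, P] \<subseteq> N \<inter> P\<close> is central in \<open>N\<close>, so \<open>M\<close> centralizes \<open>P\<close>
  (\<open>centralizes_closed_normal\<close>). Taking for \<open>P\<close> the closed normal closure of the other
  component settles every case except the one where \<open>M\<close> and \<open>L\<close> generate the same \<open>N\<close>; then both are normal
  in \<open>N\<close>, the commutators lie in \<open>M \<inter> L\<close>, and this intersection is central
  (\<open>distinct_components_commute\<close>).

  In a group of semisimple type, any closed subgroup that contains all components is the whole group.
  This applies to the normalizer of a component, so components are normal and equal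
  to their own normal closure; the defining property of components then says that \<open>M/Z(M)\<close> is
  topologically simple. It also applies to centralizers: a subset that commutes with
  every component is central. In particular \<open>Z(M)\<close> is central in the whole group, so it is trivial in the
  strict case. If \<open>X\<close> is a family of sets of components with empty intersection, then each component
  \<open>M\<close> is missing from some \<open>A \<in> X\<close>, hence commutes with the subgroup generated by \<open>A\<close>. So
  the intersection of these subgroups commutes with every component and is central, that is, trivial.
\<close>

section \<open>Centralizers and commutators\<close>

definition centralizer :: "('a, 'b) monoid_scheme \<Rightarrow> 'a set \<Rightarrow> 'a set" where
  "centralizer G A = {x \<in> carrier G. \<forall>a\<in>A. x \<otimes>\<^bsub>G\<^esub> a = a \<otimes>\<^bsub>G\<^esub> x}"

text \<open>
  Both conjugates are required, since \<open>x A x\<inverse> \<subseteq> A\<close> alone does not define a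
  subgroup when \<open>A\<close> is infinite.
\<close>

definition setwise_normalizer :: "('a, 'b) monoid_scheme \<Rightarrow> 'a set \<Rightarrow> 'a set" where
  "setwise_normalizer G A =
     {x \<in> carrier G. \<forall>a\<in>A. x \<otimes>\<^bsub>G\<^esub> a \<otimes>\<^bsub>G\<^esub> inv\<^bsub>G\<^esub> x \<in> A \<and> inv\<^bsub>G\<^esub> x \<otimes>\<^bsub>G\<^esub> a \<otimes>\<^bsub>G\<^esub> x \<in> A}"

lemma group_center_eq_centralizer: "group_center G = centralizer G (carrier G)"
  by (auto simp: group_center_def centralizer_def)

lemma centralizer_antimono: "A \<subseteq> B \<Longrightarrow> centralizer G B \<subseteq> centralizer G A"
  by (auto simp: centralizer_def)

lemma subset_centralizer_commute:
  assumes "A \<subseteq> carrier G" "B \<subseteq> carrier G"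
  shows "A \<subseteq> centralizer G B \<longleftrightarrow> B \<subseteq> centralizer G A"
  using assms unfolding centralizer_def subset_iff mem_Collect_eq by metis

lemma group_center_restrict: "M \<subseteq> carrier G \<Longrightarrow>
    group_center (G\<lparr>carrier := M\<rparr>) = M \<inter> centralizer G M"
  by (auto simp: group_center_def centralizer_def)

context group
begin

lemma mult_inv_cancel_left [simp]:
  assumes "a \<in> carrier G" "x \<in> carrier G"
  shows "a \<otimes> (inv a \<otimes> x) = x" "inv a \<otimes> (a \<otimes> x) = x"
  using assms by (simp_all flip: m_assoc)

lemma conj_mult:
  assumes "a \<in> carrier G" "b \<in> carrier G" "x \<in> carrier G"
  shows "(a \<otimes> b) \<otimes> x \<otimes> inv (a \<otimes> b) = a \<otimes> (b \<otimes> x \<otimes> inv b) \<otimes> inv a"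
  using assms by (simp add: inv_mult_group m_assoc)

lemma mult_conj:
  assumes "a \<in> carrier G" "x \<in> carrier G" "y \<in> carrier G"
  shows "a \<otimes> (x \<otimes> y) \<otimes> inv a = (a \<otimes> x \<otimes> inv a) \<otimes> (a \<otimes> y \<otimes> inv a)"
  using assms by (simp add: m_assoc)

lemma conj_conj_inv:
  assumes "a \<in> carrier G" "x \<in> carrier G"
  shows "a \<otimes> (inv a \<otimes> x \<otimes> a) \<otimes> inv a = x"
  using assms by (simp add: m_assoc)

lemma conj_eq_iff_commute:
  assumes "a \<in> carrier G" "x \<in> carrier G"
  shows "a \<otimes> x \<otimes> inv a = x \<longleftrightarrow> a \<otimes> x = x \<otimes> a"
  using assms by (metis inv_closed inv_solve_right m_closed)

lemma subgroup_centralizer: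
  assumes A: "A \<subseteq> carrier G"
  shows "subgroup (centralizer G A) G"
proof (rule subgroupI)
  show "centralizer G A \<noteq> {}"
    using A by (auto simp: centralizer_def subset_iff intro!: exI[of _ \<one>])
  fix x assume x: "x \<in> centralizer G A"
  { fix a assume "a \<in> A"
    then have a: "a \<in> carrier G" "x \<otimes> a = a \<otimes> x" "x \<in> carrier G"
      using A x by (auto simp: centralizer_def)
    have "inv x \<otimes> a = inv x \<otimes> (x \<otimes> a \<otimes> inv x)"
      using a by (metis conj_eq_iff_commute)
    also have "\<dots> = a \<otimes> inv x"
      using a(1,3) by (simp add: m_assoc)
    finally have "inv x \<otimes> a = a \<otimes> inv x" . }
  then show "inv x \<in> centralizer G A"
    using x by (simp add: centralizer_def)
  fix y assume y: "y \<in> centralizer G A"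
  { fix a assume "a \<in> A"
    then have "a \<in> carrier G" "x \<otimes> a = a \<otimes> x" "x \<in> carrier G" "y \<otimes> a = a \<otimes> y" "y \<in> carrier G"
      using A x y by (auto simp: centralizer_def)
    then have "x \<otimes> y \<otimes> a = a \<otimes> (x \<otimes> y)"
      by (metis m_assoc) }
  then show "x \<otimes> y \<in> centralizer G A"
    using x y by (simp add: centralizer_def)
qed (auto simp: centralizer_def)

lemma subgroup_setwise_normalizer:
  assumes A: "A \<subseteq> carrier G"
  shows "subgroup (setwise_normalizer G A) G"
proof (rule subgroupI)
  show "setwise_normalizer G A \<noteq> {}"
    using A by (auto simp: setwise_normalizer_def subset_iff intro!: exI[of _ \<one>])
  fix x assume x: "x \<in> setwise_normalizer G A"
  then show "inv x \<in> setwise_normalizer G A"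
    by (auto simp: setwise_normalizer_def)
  fix y assume y: "y \<in> setwise_normalizer G A"
  show "x \<otimes> y \<in> setwise_normalizer G A"
    unfolding setwise_normalizer_def
  proof (safe)
    show "x \<otimes> y \<in> carrier G"
      using x y by (simp add: setwise_normalizer_def)
    fix a assume a: "a \<in> A"
    have c: "x \<in> carrier G" "y \<in> carrier G" "a \<in> carrier G"
      using x y a A by (auto simp: setwise_normalizer_def)
    show "x \<otimes> y \<otimes> a \<otimes> inv (x \<otimes> y) \<in> A"
      using x y a c by (simp add: conj_mult setwise_normalizer_def)
    have "inv (x \<otimes> y) \<otimes> a \<otimes> (x \<otimes> y) = inv y \<otimes> (inv x \<otimes> a \<otimes> x) \<otimes> y"
      using c by (simp add: inv_mult_group m_assoc)
    then show "inv (x \<otimes> y) \<otimes> a \<otimes> (x \<otimes> y) \<in> A"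
      using x y a by (simp add: setwise_normalizer_def)
  qed
qed (auto simp: setwise_normalizer_def)

lemma commutator_in_normalized:
  assumes "subgroup H G" "g \<in> setwise_normalizer G H" "h \<in> H"
  shows "g \<otimes> h \<otimes> inv g \<otimes> inv h \<in> H" and "h \<otimes> g \<otimes> inv h \<otimes> inv g \<in> H"
proof -
  have c: "g \<in> carrier G" "h \<in> carrier G" and i: "inv h \<in> H"
    using assms subgroup.mem_carrier subgroup.m_inv_closed by (auto simp: setwise_normalizer_def)
  show "g \<otimes> h \<otimes> inv g \<otimes> inv h \<in> H"
    using assms i by (auto intro: subgroup.m_closed simp: setwise_normalizer_def)
  have "h \<otimes> (g \<otimes> inv h \<otimes> inv g) \<in> H"
    using assms i by (auto intro: subgroup.m_closed simp: setwise_normalizer_def)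
  then show "h \<otimes> g \<otimes> inv h \<otimes> inv g \<in> H"
    using c by (simp add: m_assoc)
qed

lemma conj_centralizer:
  assumes X: "X \<subseteq> carrier G" and g: "g \<in> setwise_normalizer G X" and c: "c \<in> centralizer G X"
  shows "g \<otimes> c \<otimes> inv g \<in> centralizer G X"
proof -
  have gc: "g \<in> carrier G" "c \<in> carrier G"
    using g c by (auto simp: setwise_normalizer_def centralizer_def)
  { fix x assume x: "x \<in> X"
    define y where "y = inv g \<otimes> x \<otimes> g"
    have y: "y \<in> X" "x \<in> carrier G" "y \<in> carrier G"
      using g x X by (auto simp: y_def setwise_normalizer_def)
    have xy: "x = g \<otimes> y \<otimes> inv g"
      unfolding y_def using y gc by (simp add: conj_conj_inv)
    have "g \<otimes> c \<otimes> inv g \<otimes> x = g \<otimes> (c \<otimes> y) \<otimes> inv g"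
      using gc y xy by (simp add: mult_conj)
    also have "\<dots> = g \<otimes> (y \<otimes> c) \<otimes> inv g"
      using c y by (simp add: centralizer_def)
    also have "\<dots> = x \<otimes> (g \<otimes> c \<otimes> inv g)"
      using gc y xy by (simp add: mult_conj)
    finally have "g \<otimes> c \<otimes> inv g \<otimes> x = x \<otimes> (g \<otimes> c \<otimes> inv g)" . }
  then show ?thesis
    using gc by (simp add: centralizer_def)
qed

lemma normal_setwise_normalizer:
  assumes "N \<lhd> G"
  shows "setwise_normalizer G N = carrier G"
  using assms normal.inv_op_closed1[OF assms] normal.inv_op_closed2[OF assms]
  by (auto simp: setwise_normalizer_def)

lemma normal_if_setwise_normalizer:
  assumes "subgroup N G" "setwise_normalizer G N = carrier G"
  shows "N \<lhd> G"
  using assms by (intro normal_invI) (auto simp: setwise_normalizer_def)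

lemma normal_centralizer:
  assumes "N \<lhd> G"
  shows "centralizer G N \<lhd> G"
proof -
  have "N \<subseteq> carrier G"
    using assms normal_imp_subgroup subgroup.subset by blast
  then show ?thesis
    using assms by (intro normal_invI subgroup_centralizer conj_centralizer)
      (auto simp: normal_setwise_normalizer)
qed

lemma normal_restrict_iff:
  assumes H: "subgroup H G"
  shows "K \<lhd> G\<lparr>carrier := H\<rparr> \<longleftrightarrow>
    subgroup K G \<and> K \<subseteq> H \<and> H \<subseteq> setwise_normalizer G K"
proof -
  interpret H: group "G\<lparr>carrier := H\<rparr>"
    using H subgroup_imp_group by blast
  have sub: "H \<subseteq> carrier G"
    using H by (rule subgroup.subset)
  have inv: "inv h \<in> H" if "h \<in> H" for h
    using that H by (rule subgroup.m_inv_closed[rotated])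
  have "subgroup K (G\<lparr>carrier := H\<rparr>) \<longleftrightarrow> subgroup K G \<and> K \<subseteq> H"
    using H incl_subgroup[OF H] subgroup_incl[OF _ H] subgroup.subset[of K "G\<lparr>carrier := H\<rparr>"] by auto
  moreover have "(\<forall>x\<in>H. \<forall>k\<in>K. x \<otimes> k \<otimes> inv x \<in> K) \<longleftrightarrow> H \<subseteq> setwise_normalizer G K"
  proof
    assume *: "\<forall>x\<in>H. \<forall>k\<in>K. x \<otimes> k \<otimes> inv x \<in> K"
    { fix x k assume "x \<in> H" "k \<in> K"
      then have "x \<otimes> k \<otimes> inv x \<in> K" "inv x \<otimes> k \<otimes> inv (inv x) \<in> K"
        using * inv by blast+
      then have "x \<otimes> k \<otimes> inv x \<in> K" "inv x \<otimes> k \<otimes> x \<in> K"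
        using \<open>x \<in> H\<close> sub by auto }
    then show "H \<subseteq> setwise_normalizer G K"
      using sub by (auto simp: setwise_normalizer_def)
  qed (auto simp: setwise_normalizer_def)
  ultimately show ?thesis
    unfolding H.normal_inv_iff using H by (auto simp: m_inv_consistent)
qed

lemma r_coset_mult_left:
  assumes "subgroup H G" "h \<in> H" "x \<in> carrier G"
  shows "H #> (h \<otimes> x) = H #> x"
proof -
  have "H \<subseteq> carrier G"
    using assms(1) by (rule subgroup.subset)
  then show ?thesis
    using assms by (simp add: coset_join2 subset_iff flip: coset_mult_assoc)
qed

lemma normal_group_center: "group_center G \<lhd> G"
  by (simp add: group_center_eq_centralizer normal_centralizer normal_self)

text \<open>
  The hypothesis says that every commutator is central, in a form free of inverses; this
  spares a translation between inverses in a group and in a subgroup.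
\<close>

lemma comm_group_Mod_center:
  assumes "\<And>a b. \<lbrakk>a \<in> carrier G; b \<in> carrier G\<rbrakk> \<Longrightarrow> \<exists>z\<in>group_center G. a \<otimes> b = z \<otimes> (b \<otimes> a)"
  shows "comm_group (G Mod group_center G)"
proof -
  interpret Z: normal "group_center G" G
    by (rule normal_group_center)
  show ?thesis
  proof (rule group.group_comm_groupI[OF Z.factorgroup_is_group])
    fix A B assume "A \<in> carrier (G Mod group_center G)" "B \<in> carrier (G Mod group_center G)"
    then obtain a b where a: "a \<in> carrier G" "A = group_center G #> a"
      and b: "b \<in> carrier G" "B = group_center G #> b"
      by (auto simp: carrier_FactGroup)
    obtain z where z: "z \<in> group_center G" "a \<otimes> b = z \<otimes> (b \<otimes> a)"
      using assms a b by blast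
    have "group_center G #> (a \<otimes> b) = group_center G #> (b \<otimes> a)"
      using z a b by (simp add: r_coset_mult_left Z.is_subgroup)
    then show "A \<otimes>\<^bsub>G Mod group_center G\<^esub> B = B \<otimes>\<^bsub>G Mod group_center G\<^esub> A"
      using a b by (simp add: Z.rcos_sum)
  qed
qed

text \<open>
  Here \<open>c = [a, x]\<close> and \<open>d = [b, x]\<close>. Conjugation by \<open>a b\<close> takes \<open>x\<close> to \<open>d c x\<close>, conjugation by
  \<open>b a\<close> takes it to \<open>c d x\<close>. As these agree, \<open>(b a)\<inverse> (a b)\<close> commutes with \<open>x\<close>: this is the
  statement that the homomorphism \<open>m \<mapsto> [m, x]\<close> to an abelian group kills commutators.
\<close>

lemma commutator_centralizes:
  assumes a: "a \<in> carrier G" and b: "b \<in> carrier G" and x: "x \<in> carrier G"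
    and c: "c \<in> carrier G" "a \<otimes> x \<otimes> inv a = c \<otimes> x" "b \<otimes> c = c \<otimes> b"
    and d: "d \<in> carrier G" "b \<otimes> x \<otimes> inv b = d \<otimes> x" "a \<otimes> d = d \<otimes> a"
    and cd: "c \<otimes> d = d \<otimes> c"
  shows "(inv (b \<otimes> a) \<otimes> (a \<otimes> b)) \<otimes> x = x \<otimes> (inv (b \<otimes> a) \<otimes> (a \<otimes> b))"
proof -
  have conj: "a \<otimes> d \<otimes> inv a = d" "b \<otimes> c \<otimes> inv b = c"
    using a b c d by (metis conj_eq_iff_commute)+
  define u v where "u = a \<otimes> b" and "v = b \<otimes> a"
  have uv: "u \<in> carrier G" "v \<in> carrier G"
    using a b by (simp_all add: u_def v_def)
  have "u \<otimes> x \<otimes> inv u = a \<otimes> (d \<otimes> x) \<otimes> inv a"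
    using a b x d by (simp add: u_def conj_mult)
  also have "\<dots> = d \<otimes> (c \<otimes> x)"
    using a x c(2) d(1) by (simp only: mult_conj conj)
  also have "\<dots> = c \<otimes> (d \<otimes> x)"
    using c d x cd by (metis m_assoc)
  also have "\<dots> = b \<otimes> (c \<otimes> x) \<otimes> inv b"
    using b x c(1) d(2) by (simp only: mult_conj conj)
  also have "\<dots> = v \<otimes> x \<otimes> inv v"
    using a b x c by (simp add: v_def conj_mult)
  finally have eq: "u \<otimes> x \<otimes> inv u = v \<otimes> x \<otimes> inv v" .
  have "inv v \<otimes> u \<otimes> x \<otimes> inv (inv v \<otimes> u) = inv v \<otimes> (u \<otimes> x \<otimes> inv u) \<otimes> inv (inv v)"
    using uv x by (simp add: conj_mult)
  also have "\<dots> = x"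
    unfolding eq using uv x by (simp add: m_assoc)
  finally show ?thesis
    using uv x by (simp add: conj_eq_iff_commute flip: u_def v_def)
qed

end

section \<open>Topological groups\<close>

context topological_group
begin

lemma continuous_map_mult:
  assumes "continuous_map X T f" "continuous_map X T g"
  shows "continuous_map X T (\<lambda>x. f x \<otimes> g x)"
  using continuous_map_compose[OF continuous_map_pairedI[OF assms] continuous_mult]
  by (simp add: o_def)

lemma continuous_map_inv:
  assumes "continuous_map X T f"
  shows "continuous_map X T (\<lambda>x. inv (f x))"
  using continuous_map_compose[OF assms continuous_inv] by (simp add: o_def)

lemma continuous_map_const_carrier: "a \<in> carrier G \<Longrightarrow> continuous_map X T (\<lambda>x. a)"
  by (simp add: topspace_eq_carrier)

lemmas continuous_group_intros =
  continuous_map_mult continuous_map_inv continuous_map_const_carrier continuous_map_id[unfolded id_def]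

lemma closedin_setwise_normalizer:
  assumes "closedin T A"
  shows "closedin T (setwise_normalizer G A)"
proof -
  have A: "A \<subseteq> carrier G"
    using assms closedin_subset topspace_eq_carrier by blast
  have *: "closedin T {x \<in> topspace T. x \<otimes> a \<otimes> inv x \<in> A}"
    "closedin T {x \<in> topspace T. inv x \<otimes> a \<otimes> x \<in> A}" if "a \<in> A" for a
  proof -
    have "a \<in> carrier G"
      using that A by blast
    then have "continuous_map T T (\<lambda>x. x \<otimes> a \<otimes> inv x)" "continuous_map T T (\<lambda>x. inv x \<otimes> a \<otimes> x)"
      by (auto intro!: continuous_group_intros)
    then show "closedin T {x \<in> topspace T. x \<otimes> a \<otimes> inv x \<in> A}"
      "closedin T {x \<in> topspace T. inv x \<otimes> a \<otimes> x \<in> A}"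
      using assms closedin_continuous_map_preimage by blast+
  qed
  have "setwise_normalizer G A =
      topspace T \<inter> (\<Inter>a\<in>A. {x \<in> topspace T. x \<otimes> a \<otimes> inv x \<in> A}
        \<inter> {x \<in> topspace T. inv x \<otimes> a \<otimes> x \<in> A})"
    by (auto simp: setwise_normalizer_def topspace_eq_carrier)
  also have "closedin T \<dots>"
    using * by (cases "A = {}") (auto intro!: closedin_Int closedin_Inter)
  finally show ?thesis .
qed

lemma closedin_centralizer:
  assumes "Hausdorff_space T" "A \<subseteq> carrier G"
  shows "closedin T (centralizer G A)"
proof -
  have *: "closedin T {x \<in> topspace T. x \<otimes> a = a \<otimes> x}" if "a \<in> A" for a
    using that assms by (intro closedin_continuous_maps_eq[OF assms(1)] continuous_group_intros) auto
  have "centralizer G A = topspace T \<inter> (\<Inter>a\<in>A. {x \<in> topspace T. x \<otimes> a = a \<otimes> x})"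
    by (auto simp: centralizer_def topspace_eq_carrier)
  also have "closedin T \<dots>"
    using * by (cases "A = {}") (auto intro!: closedin_Int closedin_Inter)
  finally show ?thesis .
qed

lemma topological_group_subgroup:
  assumes "subgroup H G"
  shows "topological_group (G\<lparr>carrier := H\<rparr>) (subtopology T H)"
proof -
  interpret H: group "G\<lparr>carrier := H\<rparr>"
    using assms subgroup_imp_group by blast
  have H: "H \<subseteq> carrier G"
    using assms by (rule subgroup.subset)
  show ?thesis
  proof
    show "topspace (subtopology T H) = carrier (G\<lparr>carrier := H\<rparr>)"
      using H by (auto simp: topspace_eq_carrier)
    have "continuous_map (subtopology (prod_topology T T) (H \<times> H)) T (\<lambda>(x, y). x \<otimes> y)"
      using continuous_mult by (rule continuous_map_from_subtopology)
    then have "continuous_map (prod_topology (subtopology T H) (subtopology T H)) (subtopology T H)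
        (\<lambda>(x, y). x \<otimes> y)"
      using assms by (auto simp: continuous_map_in_subtopology subtopology_Times
          dest: subgroup.m_closed)
    then show "continuous_map (prod_topology (subtopology T H) (subtopology T H)) (subtopology T H)
        (\<lambda>(x, y). x \<otimes>\<^bsub>G\<lparr>carrier := H\<rparr>\<^esub> y)"
      by simp
    have "continuous_map (subtopology T H) (subtopology T H) (\<lambda>x. inv x)"
      using continuous_map_from_subtopology[OF continuous_inv] assms
      by (auto simp: continuous_map_in_subtopology dest: subgroup.m_inv_closed)
    then show "continuous_map (subtopology T H) (subtopology T H) (\<lambda>x. inv\<^bsub>G\<lparr>carrier := H\<rparr>\<^esub> x)"
      by (rule continuous_map_eq) (simp add: assms)
  qed
qed

text \<open>
  The saturation of an open set \<open>U\<close> is the union of the preimages of \<open>U\<close> under the translations by elements of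
  \<open>N\<close>.
\<close>

lemma open_map_r_coset:
  assumes "N \<lhd> G"
  shows "open_map T (quotient_topology T (\<lambda>x. N #> x)) (\<lambda>x. N #> x)"
  unfolding open_map_def
proof (intro allI impI)
  fix U assume U: "openin T U"
  interpret N: normal N G by fact
  have Usub: "U \<subseteq> carrier G"
    using U openin_subset topspace_eq_carrier by blast
  have "{x \<in> topspace T. N #> x \<in> (#>) N ` U} = (\<Union>n\<in>N. {x \<in> topspace T. n \<otimes> x \<in> U})"
  proof (intro equalityI subsetI)
    fix x assume x: "x \<in> {x \<in> topspace T. N #> x \<in> (#>) N ` U}"
    then obtain u where u: "u \<in> U" "N #> x = N #> u" by auto
    then have "u \<in> N #> x"
      using rcos_self N.is_subgroup Usub by auto
    then obtain n where "n \<in> N" "u = n \<otimes> x"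
      by (auto simp: r_coset_def)
    then show "x \<in> (\<Union>n\<in>N. {x \<in> topspace T. n \<otimes> x \<in> U})"
      using u x by auto
  next
    fix x assume "x \<in> (\<Union>n\<in>N. {x \<in> topspace T. n \<otimes> x \<in> U})"
    then obtain n where n: "n \<in> N" "x \<in> carrier G" "n \<otimes> x \<in> U"
      by (auto simp: topspace_eq_carrier)
    then have "N #> (n \<otimes> x) = N #> x"
      by (simp add: r_coset_mult_left N.is_subgroup)
    then show "x \<in> {x \<in> topspace T. N #> x \<in> (#>) N ` U}"
      using n by (auto simp: topspace_eq_carrier intro!: image_eqI[of _ _ "n \<otimes> x"])
  qed
  moreover have "openin T {x \<in> topspace T. n \<otimes> x \<in> U}" if "n \<in> N" for n
  proof (rule openin_continuous_map_preimage[OF _ U])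
    show "continuous_map T T (\<lambda>x. n \<otimes> x)"
      using that by (intro continuous_group_intros) simp
  qed
  ultimately show "openin (quotient_topology T (\<lambda>x. N #> x)) ((#>) N ` U)"
    using Usub by (auto simp: openin_quotient_topology topspace_eq_carrier)
qed

text \<open>
  Continuity of the multiplication descends from \<open>G \<times> G\<close> because the product of two copies of the
  projection is again a quotient map. This fails for general quotient maps, but a product of open maps
  is open.
\<close>

lemma topological_group_Mod:
  assumes "N \<lhd> G"
  shows "topological_group (G Mod N) (quotient_topology T (\<lambda>x. N #> x))"
proof -
  interpret N: normal N G by fact
  interpret Q: group "G Mod N" by (rule N.factorgroup_is_group)
  let ?p = "\<lambda>x. N #> x"
  let ?Q = "quotient_topology T ?p"
  have q: "quotient_map T ?Q ?p"
    by (rule quotient_map_quotient_topology)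
  then have p: "continuous_map T ?Q ?p"
    by (rule quotient_imp_continuous_map)
  have q2: "quotient_map (prod_topology T T) (prod_topology ?Q ?Q) (\<lambda>(x, y). (?p x, ?p y))"
  proof (rule continuous_open_imp_quotient_map)
    show "continuous_map (prod_topology T T) (prod_topology ?Q ?Q) (\<lambda>(x, y). (?p x, ?p y))"
      using p unfolding continuous_map_prod_top by blast
    show "open_map (prod_topology T T) (prod_topology ?Q ?Q) (\<lambda>(x, y). (?p x, ?p y))"
      unfolding open_map_def
    proof (intro allI impI)
      fix W assume W: "openin (prod_topology T T) W"
      show "openin (prod_topology ?Q ?Q) ((\<lambda>(x, y). (?p x, ?p y)) ` W)"
        unfolding openin_prod_topology_alt
      proof (intro allI impI)
        fix A B assume "(A, B) \<in> (\<lambda>(x, y). (?p x, ?p y)) ` W"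
        then obtain x y where xy: "(x, y) \<in> W" "A = ?p x" "B = ?p y" by auto
        then obtain U V where UV: "openin T U" "openin T V" "x \<in> U" "y \<in> V" "U \<times> V \<subseteq> W"
          using W unfolding openin_prod_topology_alt by meson
        then have "openin ?Q (?p ` U)" "openin ?Q (?p ` V)"
          using open_map_r_coset[OF assms] unfolding open_map_def by blast+
        moreover have "A \<in> ?p ` U" "B \<in> ?p ` V"
          using UV xy by blast+
        moreover have "?p ` U \<times> ?p ` V \<subseteq> (\<lambda>(x, y). (?p x, ?p y)) ` W"
          using UV(5) by force
        ultimately show "\<exists>U V. openin ?Q U \<and> openin ?Q V \<and> A \<in> U \<and> B \<in> V \<and>
            U \<times> V \<subseteq> (\<lambda>(x, y). (?p x, ?p y)) ` W"
          by blast
      qed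
    qed
    show "(\<lambda>(x, y). (?p x, ?p y)) ` topspace (prod_topology T T) = topspace (prod_topology ?Q ?Q)"
      by (auto simp: topspace_quotient_topology)
  qed
  show ?thesis
  proof
    show "topspace ?Q = carrier (G Mod N)"
      by (simp add: topspace_quotient_topology carrier_FactGroup topspace_eq_carrier)
    have "continuous_map (prod_topology T T) ?Q (?p \<circ> (\<lambda>(x, y). x \<otimes> y))"
      by (rule continuous_map_compose[OF continuous_mult p])
    then have "continuous_map (prod_topology T T) ?Q
        ((\<lambda>(A, B). A \<otimes>\<^bsub>G Mod N\<^esub> B) \<circ> (\<lambda>(x, y). (?p x, ?p y)))"
      by (rule continuous_map_eq) (auto simp: topspace_eq_carrier N.rcos_sum)
    then show "continuous_map (prod_topology ?Q ?Q) ?Q (\<lambda>(A, B). A \<otimes>\<^bsub>G Mod N\<^esub> B)"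
      by (rule continuous_compose_quotient_map[OF q2])
    have "continuous_map T ?Q (?p \<circ> (\<lambda>x. inv x))"
      by (rule continuous_map_compose[OF continuous_inv p])
    then have "continuous_map T ?Q ((\<lambda>A. inv\<^bsub>G Mod N\<^esub> A) \<circ> ?p)"
      by (rule continuous_map_eq)
        (auto simp: topspace_eq_carrier N.inv_FactGroup N.rcos_inv carrier_FactGroup)
    then show "continuous_map ?Q ?Q (\<lambda>A. inv\<^bsub>G Mod N\<^esub> A)"
      by (rule continuous_compose_quotient_map[OF q])
  qed
qed

text \<open>
  Closed normal subgroups of \<open>G/Z(G)\<close> pull back to closed normal subgroups of \<open>G\<close>.
\<close>

lemma central_by_topologically_simpleI:
  assumes noncomm: "\<not> comm_group (G Mod group_center G)"
    and dich: "\<And>K. \<lbrakk>K \<lhd> G; closedin T K; K \<noteq> carrier G\<rbrakk> \<Longrightarrow> K \<subseteq> group_center G"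
  shows "central_by_topologically_simple G T"
proof -
  let ?Z = "group_center G"
  let ?p = "\<lambda>x. ?Z #> x"
  interpret Z: normal ?Z G
    by (rule normal_group_center)
  interpret Q: topological_group "G Mod ?Z" "quotient_topology T ?p"
    by (rule topological_group_Mod) (rule normal_group_center)
  interpret p: group_hom G "G Mod ?Z" ?p
    by unfold_locales (rule Z.r_coset_hom_Mod)
  have "topologically_simple (G Mod ?Z) (quotient_topology T ?p)"
  proof
    show "carrier (G Mod ?Z) \<noteq> {\<one>\<^bsub>G Mod ?Z\<^esub>}"
    proof
      assume "carrier (G Mod ?Z) = {\<one>\<^bsub>G Mod ?Z\<^esub>}"
      then have "comm_group (G Mod ?Z)"
        by (intro Q.group_comm_groupI) auto
      then show False using noncomm by simp
    qed
  next
    fix L assume L: "L \<lhd> G Mod ?Z" and cl: "closedin (quotient_topology T ?p) L"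
    interpret L: normal L "G Mod ?Z" by fact
    define K where "K = {x \<in> carrier G. ?p x \<in> L}"
    have LK: "L = ?p ` K"
      using L.subset by (auto simp: K_def carrier_FactGroup)
    have "subgroup K G"
    proof (rule subgroupI)
      have "\<one> \<in> K"
        using L.one_closed p.hom_one by (simp add: K_def)
      then show "K \<noteq> {}" by blast
    next
      fix a assume "a \<in> K"
      then show "inv a \<in> K"
        using L.m_inv_closed[of "?p a"] by (simp add: K_def)
    next
      fix a b assume "a \<in> K" "b \<in> K"
      then show "a \<otimes> b \<in> K"
        using L.m_closed[of "?p a" "?p b"] p.hom_mult[of a b] by (simp add: K_def)
    qed (auto simp: K_def)
    then have "K \<lhd> G"
    proof (rule normal_invI)
      fix x h assume "x \<in> carrier G" "h \<in> K"
      then show "x \<otimes> h \<otimes> inv x \<in> K"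
        using L.inv_op_closed2[of "?p x" "?p h"] p.hom_closed[of x]
        by (simp add: K_def p.hom_mult[symmetric] p.hom_inv[symmetric] del: mult_FactGroup p.hom_mult p.hom_inv)
    qed
    moreover have "closedin T K"
      using closedin_continuous_map_preimage[OF
          quotient_imp_continuous_map[OF quotient_map_quotient_topology] cl]
      by (simp add: K_def topspace_eq_carrier)
    ultimately consider "K = carrier G" | "K \<subseteq> ?Z"
      using dich by blast
    then show "L = {\<one>\<^bsub>G Mod ?Z\<^esub>} \<or> L = carrier (G Mod ?Z)"
    proof cases
      case 1
      then show ?thesis by (simp add: LK carrier_FactGroup)
    next
      case 2
      then have "L \<subseteq> {?Z}"
        by (auto simp: LK Z.rcos_const)
      then show ?thesis
        using L.one_closed by auto
    qed
  qed
  then show ?thesis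
    by (simp add: central_by_topologically_simple_def)
qed

lemma closed_subgroup_generated_subset:
  assumes "subgroup H G" "closedin T H" "X \<subseteq> H"
  shows "closed_subgroup_generated G T X \<subseteq> H"
  using assms by (auto simp: closed_subgroup_generated_def)

lemma one_in_closed_subgroup_generated: "\<one> \<in> closed_subgroup_generated G T X"
  by (auto simp: closed_subgroup_generated_def subgroup.one_closed)

lemma closed_normal_closure_least:
  assumes "N \<lhd> G" "closedin T N" "X \<subseteq> N"
  shows "closed_normal_closure G T X \<subseteq> N"
  using assms by (auto simp: closed_normal_closure_def)

lemma
  assumes X: "X \<subseteq> carrier G"
  shows subset_closed_normal_closure: "X \<subseteq> closed_normal_closure G T X"
    and normal_closed_normal_closure: "closed_normal_closure G T X \<lhd> G"
    and closedin_closed_normal_closure: "closedin T (closed_normal_closure G T X)"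
proof -
  let ?F = "{N. N \<lhd> G \<and> closedin T N \<and> X \<subseteq> N}"
  have "carrier G \<in> ?F"
    using X normal_self closedin_topspace[of T] by (simp add: topspace_eq_carrier)
  then have ne: "?F \<noteq> {}" by blast
  show "X \<subseteq> closed_normal_closure G T X"
    by (auto simp: closed_normal_closure_def)
  show "closedin T (closed_normal_closure G T X)"
    unfolding closed_normal_closure_def using ne by (intro closedin_Inter) auto
  show "closed_normal_closure G T X \<lhd> G"
    unfolding closed_normal_closure_def
  proof (rule normal_invI)
    show "subgroup (\<Inter>?F) G"
      using ne by (intro subgroups_Inter) (auto simp: normal_imp_subgroup)
  qed (auto dest: normal.inv_op_closed2)
qed

end

section \<open>Components\<close>

locale hausdorff_topological_group = topological_group +
  assumes hausdorff: "Hausdorff_space T"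

locale component_of_group = hausdorff_topological_group +
  fixes M
  assumes component: "group_component G T M"
begin

abbreviation N where "N \<equiv> closed_normal_closure G T M"

lemma subgroup_M: "subgroup M G" and closed_M: "closedin T M"
  using component by (auto simp: group_component_def)

lemma M_subset: "M \<subseteq> carrier G"
  using subgroup_M by (rule subgroup.subset)

lemma M_subset_N: "M \<subseteq> N" and normal_N: "N \<lhd> G" and closed_N: "closedin T N"
  using subset_closed_normal_closure normal_closed_normal_closure closedin_closed_normal_closure
    M_subset by auto

lemma subgroup_N: "subgroup N G"
  using normal_N by (rule normal_imp_subgroup)

lemma N_subset: "N \<subseteq> carrier G"
  using subgroup_N by (rule subgroup.subset)

lemma N_normalizes_M: "N \<subseteq> setwise_normalizer G M"
  using component normal_restrict_iff[OF subgroup_N] by (auto simp: group_component_def)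

lemma not_comm_Mod_center: "\<not> comm_group (G\<lparr>carrier := M\<rparr> Mod group_center (G\<lparr>carrier := M\<rparr>))"
  using component by (simp add: group_component_def)

lemma not_comm: "\<not> comm_group (G\<lparr>carrier := M\<rparr>)"
proof
  assume "comm_group (G\<lparr>carrier := M\<rparr>)"
  moreover have "subgroup (group_center (G\<lparr>carrier := M\<rparr>)) (G\<lparr>carrier := M\<rparr>)"
    using group.normal_group_center[OF subgroup_imp_group[OF subgroup_M]]
    by (rule normal_imp_subgroup)
  ultimately show False
    using comm_group.abelian_FactGroup not_comm_Mod_center by blast
qed

lemma not_subset_centralizer_N: "\<not> M \<subseteq> centralizer G N"
proof
  assume "M \<subseteq> centralizer G N"
  then have "M \<subseteq> centralizer G M"
    using centralizer_antimono[OF M_subset_N] by blast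
  then have "comm_group (G\<lparr>carrier := M\<rparr>)"
    by (intro group.group_comm_groupI subgroup_imp_group subgroup_M) (auto simp: centralizer_def)
  then show False using not_comm by simp
qed

text \<open>
  The defining property of a component, applied to the subgroup \<open>M \<inter> K\<close>.
\<close>

lemma closed_subgroup_dichotomy:
  assumes K: "subgroup K G" "closedin T K" and norm: "M \<subseteq> setwise_normalizer G K"
  shows "M \<subseteq> K \<or> M \<inter> K \<subseteq> centralizer G N"
proof (rule disjCI)
  assume "\<not> M \<inter> K \<subseteq> centralizer G N"
  moreover have "M \<inter> K \<lhd> G\<lparr>carrier := M\<rparr>"
    unfolding normal_restrict_iff[OF subgroup_M]
  proof (intro conjI)
    show "subgroup (M \<inter> K) G"
      using subgroup_M K(1) by (rule subgroups_Inter_pair)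
    show "M \<subseteq> setwise_normalizer G (M \<inter> K)"
      using norm M_subset_N N_normalizes_M by (fastforce simp: setwise_normalizer_def)
  qed simp
  moreover have "closedin (subtopology T M) (M \<inter> K)"
    using closed_M K(2) by (simp add: closedin_closed_subtopology closedin_Int)
  ultimately have "M \<inter> K = M"
    using component group_center_restrict[OF N_subset] by (fastforce simp: group_component_def)
  then show "M \<subseteq> K" by blast
qed

text \<open>
  The centralizer of \<open>X\<close> is a closed subgroup normalized by \<open>M\<close>. It contains all commutators of \<open>M\<close>
  because \<open>m \<mapsto> [m, x]\<close> is a homomorphism with abelian image. These commutators cannot all be central
  in \<open>M\<close>, so the dichotomy puts \<open>M\<close> inside the centralizer.
\<close>

lemma centralizes_if_commutators_central:
  assumes X: "X \<subseteq> carrier G" and norm: "M \<subseteq> setwise_normalizer G X"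
    and central: "\<And>m x. \<lbrakk>m \<in> M; x \<in> X\<rbrakk> \<Longrightarrow> m \<otimes> x \<otimes> inv m \<otimes> inv x \<in> centralizer G N"
  shows "M \<subseteq> centralizer G X"
proof (rule ccontr)
  assume not: "\<not> M \<subseteq> centralizer G X"
  have "M \<subseteq> setwise_normalizer G (centralizer G X)"
  proof
    fix m assume m: "m \<in> M"
    then have "m \<in> setwise_normalizer G X" "inv m \<in> setwise_normalizer G X" "m \<in> carrier G"
      using norm M_subset subgroup.m_inv_closed[OF subgroup_M m] by blast+
    then show "m \<in> setwise_normalizer G (centralizer G X)"
      using conj_centralizer[OF X, of m] conj_centralizer[OF X, of "inv m"]
      by (auto simp: setwise_normalizer_def[of G "centralizer G X"])
  qed
  then have *: "M \<inter> centralizer G X \<subseteq> centralizer G N"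
    using closed_subgroup_dichotomy[OF subgroup_centralizer[OF X] closedin_centralizer[OF hausdorff X]]
      not by blast
  interpret M: group "G\<lparr>carrier := M\<rparr>"
    using subgroup_M subgroup_imp_group by blast
  have "comm_group (G\<lparr>carrier := M\<rparr> Mod group_center (G\<lparr>carrier := M\<rparr>))"
  proof (rule M.comm_group_Mod_center)
    fix a b assume "a \<in> carrier (G\<lparr>carrier := M\<rparr>)" "b \<in> carrier (G\<lparr>carrier := M\<rparr>)"
    then have ab: "a \<in> M" "b \<in> M" by simp_all
    then have abG: "a \<in> carrier G" "b \<in> carrier G"
      using M_subset by auto
    define z where "z = inv (b \<otimes> a) \<otimes> (a \<otimes> b)"
    have zM: "z \<in> M"
      using ab subgroup_M by (simp add: z_def subgroup.m_closed subgroup.m_inv_closed)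
    have "z \<otimes> x = x \<otimes> z" if x: "x \<in> X" for x
    proof -
      have xG: "x \<in> carrier G" using x X by blast
      define comm where "comm m = m \<otimes> x \<otimes> inv m \<otimes> inv x" for m
      have comm: "comm m \<in> N" "comm m \<in> centralizer G N" "comm m \<in> carrier G"
        "m \<otimes> x \<otimes> inv m = comm m \<otimes> x" if m: "m \<in> M" for m
      proof -
        have mN: "m \<in> N" "m \<in> carrier G" using m M_subset_N M_subset by auto
        show "comm m \<in> N"
          unfolding comm_def using mN xG
          by (intro commutator_in_normalized(2) subgroup_N) (simp_all add: normal_setwise_normalizer normal_N)
        show "comm m \<in> centralizer G N"
          using central m x by (simp add: comm_def)
        then show "comm m \<in> carrier G" by (simp add: centralizer_def)
        show "m \<otimes> x \<otimes> inv m = comm m \<otimes> x"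
          using mN xG by (simp add: comm_def m_assoc)
      qed
      have "comm m \<otimes> n = n \<otimes> comm m" if "m \<in> M" "n \<in> N" for m n
        using comm(2) that by (simp add: centralizer_def)
      then have "b \<otimes> comm a = comm a \<otimes> b" "a \<otimes> comm b = comm b \<otimes> a"
        "comm a \<otimes> comm b = comm b \<otimes> comm a"
        using ab comm(1) M_subset_N by (metis subsetD)+
      then show ?thesis
        unfolding z_def
        using ab by (intro commutator_centralizes[where c = "comm a" and d = "comm b"] abG xG comm(3,4))
    qed
    then have "z \<in> M \<inter> centralizer G X"
      using zM M_subset by (auto simp: centralizer_def)
    then have zN: "z \<in> centralizer G N"
      using * by blast
    then have "z \<in> group_center (G\<lparr>carrier := M\<rparr>)"
      using zM centralizer_antimono[OF M_subset_N] by (auto simp: group_center_restrict[OF M_subset])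
    moreover have "a \<otimes> b = z \<otimes> (b \<otimes> a)"
    proof -
      have "b \<otimes> a \<in> N"
        using ab subgroup_M M_subset_N by (auto simp: subgroup.m_closed)
      then have "z \<otimes> (b \<otimes> a) = (b \<otimes> a) \<otimes> z"
        using zN by (simp add: centralizer_def)
      also have "\<dots> = a \<otimes> b"
        using abG by (simp add: z_def)
      finally show ?thesis by simp
    qed
    ultimately show "\<exists>z\<in>group_center (G\<lparr>carrier := M\<rparr>).
        a \<otimes>\<^bsub>G\<lparr>carrier := M\<rparr>\<^esub> b = z \<otimes>\<^bsub>G\<lparr>carrier := M\<rparr>\<^esub> (b \<otimes>\<^bsub>G\<lparr>carrier := M\<rparr>\<^esub> a)"
      by auto
  qed
  then show False using not_comm_Mod_center by simp
qed

text \<open>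
  A component need not be normal in the whole group, so \<open>[M, P]\<close> need not lie in \<open>M\<close>.
  The detour through \<open>N \<inter> P\<close> repairs this: elements of \<open>N\<close> do normalize \<open>M\<close>, and the result for
  \<open>N \<inter> P\<close> makes that group central in \<open>N\<close>, while it contains \<open>[M, P]\<close>.
\<close>

lemma centralizes_closed_normal:
  assumes P: "P \<lhd> G" "closedin T P" and not: "\<not> M \<subseteq> P"
  shows "M \<subseteq> centralizer G P"
proof -
  have subP: "subgroup P G" "P \<subseteq> carrier G"
    using P normal_imp_subgroup subgroup.subset by blast+
  have commP: "m \<otimes> x \<otimes> inv m \<otimes> inv x \<in> P" if "m \<in> carrier G" "x \<in> P" for m x
    using that P(1) subP(1) by (simp add: commutator_in_normalized normal_setwise_normalizer)
  have MP: "M \<inter> P \<subseteq> centralizer G N"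
    using closed_subgroup_dichotomy[OF subP(1) P(2)] not M_subset
    by (simp add: normal_setwise_normalizer P)
  have nD: "N \<inter> P \<lhd> G"
    using normal_N P(1) by (rule normal_subgroup_intersect)
  have "M \<subseteq> centralizer G (N \<inter> P)"
  proof (rule centralizes_if_commutators_central)
    show "N \<inter> P \<subseteq> carrier G" using subP by blast
    show "M \<subseteq> setwise_normalizer G (N \<inter> P)"
      using nD M_subset by (simp add: normal_setwise_normalizer)
    fix m x assume m: "m \<in> M" and x: "x \<in> N \<inter> P"
    have "m \<otimes> x \<otimes> inv m \<otimes> inv x \<in> M"
      using m x N_normalizes_M by (intro commutator_in_normalized subgroup_M) auto
    then show "m \<otimes> x \<otimes> inv m \<otimes> inv x \<in> centralizer G N"
      using MP commP[of m x] m x M_subset by blast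
  qed
  \<comment> \<open>The centralizer of a normal subgroup is normal, so it contains \<open>N\<close> as soon as it contains \<open>M\<close>.\<close>
  then have "N \<subseteq> centralizer G (N \<inter> P)"
    using subP by (intro closed_normal_closure_least normal_centralizer nD
        closedin_centralizer[OF hausdorff]) auto
  then have D: "N \<inter> P \<subseteq> centralizer G N"
    using N_subset subset_centralizer_commute[of N G "N \<inter> P"] by blast
  show "M \<subseteq> centralizer G P"
  proof (rule centralizes_if_commutators_central)
    show "P \<subseteq> carrier G" by fact
    show "M \<subseteq> setwise_normalizer G P"
      using P M_subset by (simp add: normal_setwise_normalizer)
    fix m x assume m: "m \<in> M" and x: "x \<in> P"
    have "m \<otimes> x \<otimes> inv m \<otimes> inv x \<in> N"
      using m x M_subset_N subP normal_N
      by (intro commutator_in_normalized subgroup_N) (auto simp: normal_setwise_normalizer)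
    then show "m \<otimes> x \<otimes> inv m \<otimes> inv x \<in> centralizer G N"
      using D commP[of m x] m x M_subset by blast
  qed
qed

end

context hausdorff_topological_group
begin

lemma component_locale: "group_component G T M \<Longrightarrow> component_of_group G T M"
  by (simp add: component_of_group_def component_of_group_axioms_def hausdorff_topological_group_axioms)

text \<open>
  If one of the components lies outside the closed normal closure of the other, it centralizes that closure.
  Otherwise the two closures coincide, and each component normalizes the other.
\<close>

lemma distinct_components_commute:
  assumes 1: "group_component G T M" and 2: "group_component G T L" and ne: "M \<noteq> L"
  shows "M \<subseteq> centralizer G L"
proof -
  interpret M: component_of_group G T M
    using 1 by (rule component_locale)
  interpret L: component_of_group G T L
    using 2 by (rule component_locale)
  consider "\<not> M \<subseteq> L.N" | "\<not> L \<subseteq> M.N" | "M \<subseteq> L.N" "L \<subseteq> M.N" by blast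
  then show ?thesis
  proof cases
    case 1
    then have "M \<subseteq> centralizer G L.N"
      using M.centralizes_closed_normal[OF L.normal_N L.closed_N] by blast
    then show ?thesis
      using centralizer_antimono[OF L.M_subset_N] by blast
  next
    case 2
    then have "L \<subseteq> centralizer G M.N"
      using L.centralizes_closed_normal[OF M.normal_N M.closed_N] by blast
    then show ?thesis
      using centralizer_antimono[OF M.M_subset_N]
        subset_centralizer_commute[OF M.M_subset L.M_subset] by blast
  next
    case 3
    have eq: "M.N = L.N"
      using 3 by (intro equalityI closed_normal_closure_least M.normal_N L.normal_N M.closed_N L.closed_N)
    have M_norm_L: "M \<subseteq> setwise_normalizer G L" and L_norm_M: "L \<subseteq> setwise_normalizer G M"
      using 3 M.N_normalizes_M L.N_normalizes_M by auto
    \<comment> \<open>If \<open>M\<close> were inside \<open>L\<close>, it would be a proper closed normal subgroup of the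
        component \<open>L\<close> and hence central.\<close>
    have "\<not> M \<subseteq> L"
    proof
      assume "M \<subseteq> L"
      then have "L \<inter> M \<subseteq> centralizer G L.N"
        using L.closed_subgroup_dichotomy[OF M.subgroup_M M.closed_M L_norm_M] ne by blast
      then show False
        using \<open>M \<subseteq> L\<close> M.not_subset_centralizer_N eq by (simp add: Int_absorb1)
    qed
    then have int: "M \<inter> L \<subseteq> centralizer G M.N"
      using M.closed_subgroup_dichotomy[OF L.subgroup_M L.closed_M M_norm_L] by blast
    show ?thesis
    proof (rule M.centralizes_if_commutators_central[OF L.M_subset M_norm_L])
      fix m x assume m: "m \<in> M" and x: "x \<in> L"
      have "m \<otimes> x \<otimes> inv m \<otimes> inv x \<in> L"
        using m x M_norm_L by (intro commutator_in_normalized L.subgroup_M) auto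
      moreover have "m \<otimes> x \<otimes> inv m \<otimes> inv x \<in> M"
        using m x L_norm_M by (intro commutator_in_normalized M.subgroup_M) auto
      ultimately show "m \<otimes> x \<otimes> inv m \<otimes> inv x \<in> centralizer G M.N"
        using int by blast
    qed
  qed
qed

section \<open>Groups of semisimple type\<close>

lemma semisimple_carrier_subset:
  assumes "semisimple_type G T" "subgroup H G" "closedin T H"
    and "\<And>M. group_component G T M \<Longrightarrow> M \<subseteq> H"
  shows "H = carrier G"
proof
  show "H \<subseteq> carrier G" using assms(2) by (rule subgroup.subset)
  have "closed_subgroup_generated G T (\<Union>(group_components G T)) \<subseteq> H"
    using assms(2-4) by (intro closed_subgroup_generated_subset) (auto simp: group_components_def)
  then show "carrier G \<subseteq> H"
    using assms(1) by (simp add: semisimple_type_def layer_def)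
qed

text \<open>
  The normalizer of \<open>M\<close> is closed. It contains \<open>M\<close>, and it contains the other components because they
  even centralize \<open>M\<close>.
\<close>

lemma semisimple_component_normal:
  assumes ss: "semisimple_type G T" and M: "group_component G T M"
  shows "M \<lhd> G"
proof -
  interpret M: component_of_group G T M
    using M by (rule component_locale)
  have "setwise_normalizer G M = carrier G"
  proof (rule semisimple_carrier_subset[OF ss])
    show "subgroup (setwise_normalizer G M) G"
      by (rule subgroup_setwise_normalizer) (rule M.M_subset)
    show "closedin T (setwise_normalizer G M)"
      by (rule closedin_setwise_normalizer) (rule M.closed_M)
    fix L assume L: "group_component G T L"
    show "L \<subseteq> setwise_normalizer G M"
    proof (cases "L = M")
      case True
      then show ?thesis using M.M_subset_N M.N_normalizes_M by blast
    next
      case False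
      show ?thesis
      proof
        fix x assume "x \<in> L"
        then have "x \<in> centralizer G M"
          using distinct_components_commute[OF L M False] by blast
        then have x: "x \<in> carrier G" "\<And>m. m \<in> M \<Longrightarrow> x \<otimes> m = m \<otimes> x" "x \<in> centralizer G M"
          by (auto simp: centralizer_def)
        have "inv x \<in> centralizer G M"
          using subgroup_centralizer[OF M.M_subset] x(3) by (rule subgroup.m_inv_closed)
        then have "inv x \<otimes> m = m \<otimes> inv x" if "m \<in> M" for m
          using that by (simp add: centralizer_def)
        then show "x \<in> setwise_normalizer G M"
          using x M.M_subset by (auto simp: setwise_normalizer_def m_assoc subset_iff)
      qed
    qed
  qed
  then show ?thesis
    using M.subgroup_M by (intro normal_if_setwise_normalizer)
qed

text \<open>
  The centralizer of \<open>X\<close> is a closed subgroup containing all components, so it is the whole group.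
\<close>

lemma semisimple_components_centralizer:
  assumes ss: "semisimple_type G T" and X: "X \<subseteq> carrier G"
    and comm: "\<And>M. group_component G T M \<Longrightarrow> M \<subseteq> centralizer G X"
  shows "X \<subseteq> group_center G"
proof -
  have "centralizer G X = carrier G"
    using X comm by (intro semisimple_carrier_subset[OF ss] subgroup_centralizer
        closedin_centralizer[OF hausdorff])
  then show ?thesis
    using X subset_centralizer_commute[of X G "carrier G"] by (simp add: group_center_eq_centralizer)
qed

text \<open>
  A component is now its own closed normal closure, so the centre of that closure, in which proper
  closed normal subgroups lie, is the centre of the component itself.
\<close>

lemma semisimple_closed_normal_dichotomy:
  assumes ss: "semisimple_type G T" and M: "group_component G T M"
    and K: "K \<lhd> G\<lparr>carrier := M\<rparr>" "closedin (subtopology T M) K" "K \<noteq> M"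
  shows "K \<subseteq> group_center (G\<lparr>carrier := M\<rparr>)"
proof -
  interpret M: component_of_group G T M
    using M by (rule component_locale)
  have "M.N = M"
    using semisimple_component_normal[OF ss M] M.closed_M M.M_subset_N
    by (intro equalityI closed_normal_closure_least) auto
  then show ?thesis
    using M K by (simp add: group_component_def)
qed

lemma semisimple_center_component:
  assumes ss: "semisimple_type G T" and M: "group_component G T M"
  shows "group_center (G\<lparr>carrier := M\<rparr>) \<subseteq> group_center G"
proof -
  interpret M: component_of_group G T M
    using M by (rule component_locale)
  let ?Z = "group_center (G\<lparr>carrier := M\<rparr>)"
  have Z: "?Z = M \<inter> centralizer G M"
    by (rule group_center_restrict) (rule M.M_subset)
  show ?thesis
  proof (rule semisimple_components_centralizer[OF ss])
    show "?Z \<subseteq> carrier G" using Z M.M_subset by blast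
    fix L assume L: "group_component G T L"
    show "L \<subseteq> centralizer G ?Z"
    proof (cases "L = M")
      case True
      then show ?thesis
        using Z M.M_subset subset_centralizer_commute[of ?Z G M] by blast
    next
      case False
      then have "L \<subseteq> centralizer G M"
        by (rule distinct_components_commute[OF L M])
      then show ?thesis
        using Z centralizer_antimono[of ?Z M G] by blast
    qed
  qed
qed

lemma component_nontrivial: "group_component G T M \<Longrightarrow> M \<noteq> {\<one>}"
proof
  assume M: "group_component G T M" "M = {\<one>}"
  interpret M: component_of_group G T M
    using M(1) by (rule component_locale)
  show False
    using M.not_subset_centralizer_N M(2) M.N_subset by (auto simp: centralizer_def subset_iff)
qed

lemma semisimple_generalized_central_factorization:
  assumes ss: "semisimple_type G T"
  shows "generalized_central_factorization G T (group_components G T)"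
proof -
  have "commutator_subgroup G M L = {\<one>}"
    if M: "group_component G T M" and L: "group_component G T L" and ne: "M \<noteq> L" for M L
  proof -
    interpret M: component_of_group G T M
      using M by (rule component_locale)
    interpret L: component_of_group G T L
      using L by (rule component_locale)
    have "a \<otimes> b \<otimes> inv a \<otimes> inv b = \<one>" if "a \<in> M" "b \<in> L" for a b
    proof -
      have "a \<in> carrier G" "b \<in> carrier G" "a \<otimes> b = b \<otimes> a"
        using that M.M_subset L.M_subset distinct_components_commute[OF M L ne]
        by (auto simp: centralizer_def)
      then show ?thesis by (simp add: m_assoc)
    qed
    then have "(\<Union>a\<in>M. \<Union>b\<in>L. {a \<otimes> b \<otimes> inv a \<otimes> inv b}) = {\<one>}"
      using subgroup.one_closed[OF M.subgroup_M] subgroup.one_closed[OF L.subgroup_M] by fastforce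
    then show ?thesis
      by (simp add: commutator_subgroup_def generate_one)
  qed
  moreover have "closed_subgroup_generated G T (\<Union>(group_components G T)) = carrier G"
    using ss by (simp add: semisimple_type_def layer_def)
  moreover have "{\<one>} \<notin> group_components G T"
    using component_nontrivial by (auto simp: group_components_def)
  ultimately show ?thesis
    using semisimple_component_normal[OF ss] component_of_group.closed_M[OF component_locale]
    by (auto simp: generalized_central_factorization_def group_components_def)
qed

text \<open>
  The argument covers the empty family \<open>X\<close> uniformly: it is admissible only if there are no components at
  all, and then commuting with every component is a vacuous condition.
\<close>

lemma strict_semisimple_quasi_direct_factorization:
  assumes strict: "strict_semisimple_type G T"
  shows "quasi_direct_factorization G T (group_components G T)"
proof -
  let ?S = "group_components G T"
  have ss: "semisimple_type G T" and Z: "group_center G = {\<one>}"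
    using strict by (auto simp: strict_semisimple_type_def)
  have "carrier G \<inter> (\<Inter>A\<in>X. closed_subgroup_generated G T (\<Union>A)) = {\<one>}" (is "?D = _")
    if X: "X \<subseteq> Pow ?S" "?S \<inter> \<Inter>X = {}" for X
  proof
    have "?D \<subseteq> group_center G"
    proof (rule semisimple_components_centralizer[OF ss])
      fix M assume M: "group_component G T M"
      interpret M: component_of_group G T M
        using M by (rule component_locale)
      \<comment> \<open>No component belongs to all members of \<open>X\<close>.\<close>
      obtain A where A: "A \<in> X" "M \<notin> A"
        using X(2) M by (auto simp: group_components_def)
      have "L \<subseteq> centralizer G M" if "L \<in> A" for L
        using that A X(1) M by (intro distinct_components_commute) (auto simp: group_components_def)
      then have "closed_subgroup_generated G T (\<Union>A) \<subseteq> centralizer G M"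
        using M.M_subset by (intro closed_subgroup_generated_subset subgroup_centralizer
            closedin_centralizer[OF hausdorff]) auto
      then have "?D \<subseteq> centralizer G M" using A by blast
      then show "M \<subseteq> centralizer G ?D"
        using subset_centralizer_commute[of ?D G M] M.M_subset by blast
    qed simp
    then show "?D \<subseteq> {\<one>}" by (simp add: Z)
    show "{\<one>} \<subseteq> ?D" by (simp add: one_in_closed_subgroup_generated)
  qed
  then show ?thesis
    using semisimple_generalized_central_factorization[OF ss]
    by (auto simp: quasi_direct_factorization_def generalized_central_factorization_def)
qed

lemma semisimple_component_central_by_simple:
  assumes ss: "semisimple_type G T" and M: "group_component G T M"
  shows "central_by_topologically_simple (G\<lparr>carrier := M\<rparr>) (subtopology T M)"
proof -
  interpret M: component_of_group G T M
    using M by (rule component_locale)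
  interpret H: topological_group "G\<lparr>carrier := M\<rparr>" "subtopology T M"
    by (rule topological_group_subgroup) (rule M.subgroup_M)
  show ?thesis
    using M.not_comm_Mod_center semisimple_closed_normal_dichotomy[OF ss M]
    by (intro H.central_by_topologically_simpleI) auto
qed

lemma strict_semisimple_component_simple:
  assumes strict: "strict_semisimple_type G T" and M: "group_component G T M"
  shows "topologically_simple (G\<lparr>carrier := M\<rparr>) (subtopology T M)"
proof -
  have ss: "semisimple_type G T" and Z: "group_center G = {\<one>}"
    using strict by (auto simp: strict_semisimple_type_def)
  interpret M: component_of_group G T M
    using M by (rule component_locale)
  interpret H: topological_group "G\<lparr>carrier := M\<rparr>" "subtopology T M"
    by (rule topological_group_subgroup) (rule M.subgroup_M)
  show ?thesis
  proof
    show "carrier (G\<lparr>carrier := M\<rparr>) \<noteq> {\<one>\<^bsub>G\<lparr>carrier := M\<rparr>\<^esub>}"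
      using component_nontrivial[OF M] by simp
    fix K assume K: "K \<lhd> G\<lparr>carrier := M\<rparr>" "closedin (subtopology T M) K"
    have "K \<subseteq> {\<one>}" if "K \<noteq> M"
      using semisimple_closed_normal_dichotomy[OF ss M K that]
        semisimple_center_component[OF ss M] Z by blast
    moreover have "\<one> \<in> K"
      using subgroup.one_closed[OF normal_imp_subgroup[OF K(1)]] by simp
    ultimately show "K = {\<one>\<^bsub>G\<lparr>carrier := M\<rparr>\<^esub>} \<or> K = carrier (G\<lparr>carrier := M\<rparr>)"
      by auto
  qed
qed

end

theorem theorem1p11:
  fixes G :: "('a, 'b) monoid_scheme" and T :: "'a topology"
  assumes "topological_group G T"
    and "Hausdorff_space T"
    and "carrier G \<noteq> {\<one>\<^bsub>G\<^esub>}"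
  shows "(semisimple_type G T \<longrightarrow>
            generalized_central_factorization G T (group_components G T) \<and>
            (\<forall>M\<in>group_components G T.
               \<not> comm_group (G\<lparr>carrier := M\<rparr>) \<and>
               central_by_topologically_simple (G\<lparr>carrier := M\<rparr>) (subtopology T M))) \<and>
         (strict_semisimple_type G T \<longrightarrow>
            quasi_direct_factorization G T (group_components G T) \<and>
            (\<forall>M\<in>group_components G T.
               \<not> comm_group (G\<lparr>carrier := M\<rparr>) \<and>
               topologically_simple (G\<lparr>carrier := M\<rparr>) (subtopology T M)))"
proof -
  interpret hausdorff_topological_group G T
    using assms by (simp add: hausdorff_topological_group_def hausdorff_topological_group_axioms_def)
  have "\<not> comm_group (G\<lparr>carrier := M\<rparr>)" if "group_component G T M" for M
    using component_of_group.not_comm[OF component_locale[OF that]] .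
  then show ?thesis
    using semisimple_generalized_central_factorization semisimple_component_central_by_simple
      strict_semisimple_quasi_direct_factorization strict_semisimple_component_simple
    by (auto simp: group_components_def)
qed

end
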